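(* Let the LASER algorithm with parameters $0<b<c$ be run on a sequence $(\mathbf x_1,y_1),\dots,(\mathbf x_T,y_T)\in\mathbb R^d\times\mathbb R$ with $\|\mathbf x_t\|^2\le X^2$ and $|y_t|\le Y$ for all $t$, where $X,Y>0$. Then for all $\mathbf u_1,\dots,\mathbf u_T\in\mathbb R^d$, writing $V^{(2)}=V^{(2)}_T(\{\mathbf u_t\})$, $$L_T(\mathrm{LASER})\le b\|\mathbf u_1\|^2+L_T(\{\mathbf u_t\})+Y^2\ln\left|\tfrac1bD_T\right|+c^{-1}Y^2\,\mathrm{Tr}(D_0)+c\,V^{(2)}+c^{-1}Y^2Td\,\max\left\{\frac{3X^2+\sqrt{X^4+4X^2c}}{2},\,b+X^2\right\}.$$ Furthermore, suppose $b=\varepsilon c$ for some $0<\varepsilon<1$, let $\mu=\max\left\{\frac98X^2,\frac{(b+X^2)^2}{8X^2}\right\}$, and suppose $V^{(2)}>0$. If $V^{(2)}\le T\,\frac{\sqrt2\,Y^2dX}{\mu^{3/2}}$ and $$c=\left(\frac{\sqrt2\,T\,Y^2dX}{V^{(2)}}\right)^{2/3},$$ then $$L_T(\mathrm{LASER})\le b\|\mathbf u_1\|^2+3\left(\sqrt2\,Y^2dX\right)^{2/3}T^{2/3}\left(V^{(2)}\right)^{1/3}+\frac{\varepsilon}{1-\varepsilon}Y^2d+L_T(\{\mathbf u_t\})+Y^2\ln\left|\tfrac1bD_T\right|.$$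
   Context: Norms are Euclidean; $|A|$ denotes the determinant of a matrix $A$. LASER with parameters $0<b<c$: $D_0=\frac{bc}{c-b}I\in\mathbb R^{d\times d}$, $\mathbf e_0=0\in\mathbb R^d$, and for $t\ge1$ $$D_t=\left(D_{t-1}^{-1}+c^{-1}I\right)^{-1}+\mathbf x_t\mathbf x_t^\top,\qquad \mathbf e_t=\left(I+c^{-1}D_{t-1}\right)^{-1}\mathbf e_{t-1}+y_t\mathbf x_t.$$ Its prediction at round $t$ is $\hat y_t=\mathbf x_t^\top D_t^{-1}\left(I+c^{-1}D_{t-1}\right)^{-1}\mathbf e_{t-1}$. Notation: $L_T(\mathrm{LASER})=\sum_{t=1}^T(y_t-\hat y_t)^2$, $L_T(\{\mathbf u_t\})=\sum_{t=1}^T(y_t-\mathbf u_t^\top\mathbf x_t)^2$, $V_T^{(2)}(\{\mathbf u_t\})=\sum_{t=1}^{T-1}\|\mathbf u_{t+1}-\mathbf u_t\|^2$. *)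

theory Defs
  imports "HOL-Analysis.Analysis"
begin

definition outer :: "real^'n \<Rightarrow> real^'n \<Rightarrow> real^'n^'n" where
  "outer v w = (\<chi> i j. v $ i * w $ j)"

text \<open>
  Sequences are functions on \<open>nat\<close> whose rounds are numbered from 1; the values
  \<open>x 0\<close>, \<open>y 0\<close> and \<open>u 0\<close> are never used. The dimension is \<open>CARD('n)\<close>.
\<close>

fun laser_D :: "real \<Rightarrow> real \<Rightarrow> (nat \<Rightarrow> real^'n) \<Rightarrow> nat \<Rightarrow> real^'n^'n" where
  "laser_D b c x 0 = (b * c / (c - b)) *\<^sub>R mat 1"
| "laser_D b c x (Suc t) =
     matrix_inv (matrix_inv (laser_D b c x t) + inverse c *\<^sub>R mat 1)
       + outer (x (Suc t)) (x (Suc t))"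

fun laser_e ::
  "real \<Rightarrow> real \<Rightarrow> (nat \<Rightarrow> real^'n) \<Rightarrow> (nat \<Rightarrow> real) \<Rightarrow> nat \<Rightarrow> real^'n" where
  "laser_e b c x y 0 = 0"
| "laser_e b c x y (Suc t) =
     matrix_inv (mat 1 + inverse c *\<^sub>R laser_D b c x t) *v laser_e b c x y t
       + y (Suc t) *\<^sub>R x (Suc t)"

text \<open>The prediction at round \<open>t\<close>, meaningful for \<open>t \<ge> 1\<close> only.\<close>

definition laser_pred ::
  "real \<Rightarrow> real \<Rightarrow> (nat \<Rightarrow> real^'n) \<Rightarrow> (nat \<Rightarrow> real) \<Rightarrow> nat \<Rightarrow> real" where
  "laser_pred b c x y t =
     x t \<bullet> (matrix_inv (laser_D b c x t) *v
       (matrix_inv (mat 1 + inverse c *\<^sub>R laser_D b c x (t - 1)) *v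
         laser_e b c x y (t - 1)))"

definition laser_loss ::
  "real \<Rightarrow> real \<Rightarrow> (nat \<Rightarrow> real^'n) \<Rightarrow> (nat \<Rightarrow> real) \<Rightarrow> nat \<Rightarrow> real" where
  "laser_loss b c x y T = (\<Sum>t=1..T. (y t - laser_pred b c x y t)\<^sup>2)"

definition comparator_loss ::
  "(nat \<Rightarrow> real^'n) \<Rightarrow> (nat \<Rightarrow> real) \<Rightarrow> (nat \<Rightarrow> real^'n) \<Rightarrow> nat \<Rightarrow> real" where
  "comparator_loss x y u T = (\<Sum>t=1..T. (y t - u t \<bullet> x t)\<^sup>2)"

definition total_drift :: "(nat \<Rightarrow> real^'n) \<Rightarrow> nat \<Rightarrow> real" where
  "total_drift u T = (\<Sum>t=1..<T. (norm (u (Suc t) - u t))\<^sup>2)"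

end

theory Submission imports Defs begin

text \<open>
  LASER is recursive minimisation of a quadratic. Put \<open>K\<^sub>t = (I + c\<^sup>-\<^sup>1 D\<^sub>t)\<^sup>-\<^sup>1\<close>. The minimum of
  \<open>b |u\<^sub>1|\<^sup>2 + c V + L\<close> over \<open>u\<^sub>1, \<dots>, u\<^sub>t\<^sub>-\<^sub>1\<close> is at least \<open>u\<^sub>t \<bullet> D\<^sub>t u\<^sub>t - 2 u\<^sub>t \<bullet> e\<^sub>t + f\<^sub>t\<close>, where \<open>f\<^sub>t\<close> is
  the sum of \<open>y\<^sub>s\<^sup>2 - c\<^sup>-\<^sup>1 e\<^sub>s\<^sub>-\<^sub>1 \<bullet> K\<^sub>s\<^sub>-\<^sub>1 e\<^sub>s\<^sub>-\<^sub>1\<close> over \<open>s \<le> t\<close>, and hence at least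
  \<open>W\<^sub>t = f\<^sub>t - e\<^sub>t \<bullet> D\<^sub>t\<^sup>-\<^sup>1 e\<^sub>t\<close> for every \<open>u\<^sub>t\<close>. On the other hand the loss suffered in round \<open>t\<close> is at most
  \<open>W\<^sub>t - W\<^sub>t\<^sub>-\<^sub>1 + y\<^sub>t\<^sup>2 x\<^sub>t \<bullet> D\<^sub>t\<^sup>-\<^sup>1 x\<^sub>t\<close>, so the regret is at most \<open>Y\<^sup>2\<close> times the sum of the leverages
  \<open>x\<^sub>t \<bullet> D\<^sub>t\<^sup>-\<^sup>1 x\<^sub>t\<close>. Without drift these telescope to a log-determinant; the shrinkage from
  \<open>D\<^sub>t\<^sub>-\<^sub>1\<close> to \<open>K\<^sub>t\<^sub>-\<^sub>1 D\<^sub>t\<^sub>-\<^sub>1\<close> costs in addition \<open>ln det (I + c\<^sup>-\<^sup>1 D\<^sub>t\<^sub>-\<^sub>1) \<le> c\<^sup>-\<^sup>1 Tr D\<^sub>t\<^sub>-\<^sub>1\<close>, which Hadamard's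
  inequality gives. Finally, all \<open>D\<^sub>t\<close> with \<open>t \<ge> 1\<close> are bounded, as quadratic forms, by a fixed
  point estimate for \<open>B \<mapsto> c B / (c + B) + X\<^sup>2\<close>.
\<close>

subsection \<open>Positive definite matrices\<close>

definition pos_def :: "real^'n^'n \<Rightarrow> bool" where
  "pos_def A \<longleftrightarrow> transpose A = A \<and> (\<forall>v. v \<noteq> 0 \<longrightarrow> 0 < v \<bullet> (A *v v))"

text \<open>Symmetry is tested on the bilinear form, so the closure lemmas below need not compare
  entries.\<close>

lemma pos_defI:
  assumes "\<And>v w. v \<bullet> (A *v w) = w \<bullet> (A *v v)" "\<And>v. v \<noteq> 0 \<Longrightarrow> 0 < v \<bullet> (A *v v)"
  shows "pos_def A"
proof -
  have "v \<bullet> (transpose A *v w) = v \<bullet> (A *v w)" for v w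
    using assms(1)[of v w] dot_lmul_matrix[of w A v]
    by (simp add: inner_commute del: vector_transpose_matrix)
  then have "transpose A = A"
    by (simp only: matrix_eq vector_eq_ldot) (metis vector_eq_ldot)
  with assms(2) show ?thesis by (simp add: pos_def_def)
qed

lemma pos_def_sym:
  assumes "pos_def A"
  shows "v \<bullet> (A *v w) = w \<bullet> (A *v v)"
  using assms dot_lmul_matrix[of w A v] transpose_matrix_vector[of A w]
  by (simp add: pos_def_def inner_commute)

lemma pos_def_pos: "pos_def A \<Longrightarrow> v \<noteq> 0 \<Longrightarrow> 0 < v \<bullet> (A *v v)"
  by (simp add: pos_def_def)

lemma pos_def_nonneg: "pos_def A \<Longrightarrow> 0 \<le> v \<bullet> (A *v v)"
  by (cases "v = 0") (auto dest: pos_def_pos intro: less_imp_le)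

lemma pos_def_entry_sym: "pos_def A \<Longrightarrow> A $ i $ j = A $ j $ i"
  unfolding pos_def_def transpose_def by (metis vec_lambda_beta)

lemma pos_def_diag: "pos_def A \<Longrightarrow> 0 < A $ i $ i"
  using pos_def_pos[of A "axis i 1"]
  by (simp add: inner_axis_axis matrix_vector_mul_component inner_axis inner_axis' axis_eq_0_iff)

lemma pos_def_invertible:
  assumes "pos_def A" shows "invertible A"
  unfolding invertible_left_inverse matrix_left_invertible_ker
  using pos_def_pos[OF assms] by force

lemma matrix_inv_vector:
  fixes A :: "real^'n^'n"
  assumes "invertible A"
  shows "A *v (matrix_inv A *v v) = v" "matrix_inv A *v (A *v v) = v"
proof -
  have "A ** matrix_inv A = mat 1 \<and> matrix_inv A ** A = mat 1"
    using assms unfolding invertible_def matrix_inv_def by (rule someI_ex)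
  then show "A *v (matrix_inv A *v v) = v" "matrix_inv A *v (A *v v) = v"
    by (simp_all add: matrix_vector_mul_assoc)
qed

lemmas pos_def_inv_vector = matrix_inv_vector[OF pos_def_invertible]

lemma pos_def_matrix_inv:
  assumes "pos_def A" shows "pos_def (matrix_inv A)"
proof (rule pos_defI)
  fix v w :: "real^'a"
  show "v \<bullet> (matrix_inv A *v w) = w \<bullet> (matrix_inv A *v v)"
    using pos_def_sym[OF assms, of "matrix_inv A *v v" "matrix_inv A *v w"]
    by (simp add: pos_def_inv_vector[OF assms] inner_commute)
  assume "v \<noteq> 0"
  then have "matrix_inv A *v v \<noteq> 0"
    using pos_def_inv_vector(1)[OF assms, of v] by force
  from pos_def_pos[OF assms this] show "0 < v \<bullet> (matrix_inv A *v v)"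
    by (simp add: pos_def_inv_vector[OF assms] inner_commute)
qed

lemma pos_def_add: "pos_def A \<Longrightarrow> pos_def B \<Longrightarrow> pos_def (A + B)"
  by (rule pos_defI)
    (simp_all add: algebra_simps pos_def_pos add_pos_pos pos_def_sym[of A] pos_def_sym[of B])

lemma pos_def_scaleR: "pos_def A \<Longrightarrow> 0 < k \<Longrightarrow> pos_def (k *\<^sub>R A)"
  by (rule pos_defI)
    (simp_all add: scaleR_matrix_vector_assoc[symmetric] pos_def_pos, metis pos_def_sym)

lemma pos_def_mat_1: "pos_def (mat 1)"
  by (rule pos_defI) (simp_all add: inner_commute)

section \<open>Rank-one updates and explicit changes of basis\<close>

lemma outer_vector: "outer v w *v z = (w \<bullet> z) *\<^sub>R v"
  by (simp add: vec_eq_iff outer_def matrix_vector_mult_def inner_vec_def sum_distrib_left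
      sum_distrib_right mult_ac)

lemma pos_def_add_outer:
  assumes "pos_def A" shows "pos_def (A + outer x x)"
proof (rule pos_defI)
  fix v w
  show "v \<bullet> ((A + outer x x) *v w) = w \<bullet> ((A + outer x x) *v v)"
    using pos_def_sym[OF assms, of v w]
    by (simp add: algebra_simps outer_vector inner_commute)
  show "v \<noteq> 0 \<Longrightarrow> 0 < v \<bullet> ((A + outer x x) *v v)"
    using pos_def_pos[OF assms, of v]
    by (simp add: algebra_simps outer_vector inner_commute add_pos_nonneg)
qed

text \<open>A change of basis with a determinant that can be read off; the rank-one determinant
  formula and the elimination step both factor through it.\<close>

definition replace_row :: "'n \<Rightarrow> real^'n \<Rightarrow> real^'n^'n" where
  "replace_row k r = (\<chi> i j. if i = k then r $ j else mat 1 $ i $ j)"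

text \<open>Cramer's rule for the identity system with right-hand side \<open>r\<close>.\<close>

lemma det_replace_row: "det (replace_row k r) = r $ k"
proof -
  have "transpose (replace_row k r) = (\<chi> i j. if j = k then (mat 1 *v r) $ i else mat 1 $ i $ j)"
    by (simp add: vec_eq_iff transpose_def replace_row_def) (simp add: mat_def)
  then show ?thesis
    using cramer_lemma[of k "mat 1" r] det_transpose[of "replace_row k r"] by simp
qed

lemma replace_row_vector:
  "replace_row k r *v v = v + (r \<bullet> v - v $ k) *\<^sub>R axis k 1"
proof -
  have "(\<Sum>j\<in>UNIV. mat 1 $ i $ j * v $ j) = v $ i" for i
    using matrix_vector_mul_lid[of v] by (simp add: matrix_vector_mult_def vec_eq_iff)
  then show ?thesis
    by (auto simp add: vec_eq_iff replace_row_def matrix_vector_mult_def inner_vec_def axis_def)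
qed

lemma transpose_replace_row_vector:
  "transpose (replace_row k r) *v v = v + v $ k *\<^sub>R (r - axis k 1)"
proof -
  have "z \<bullet> (transpose (replace_row k r) *v v) = z \<bullet> (v + v $ k *\<^sub>R (r - axis k 1))" for z
    using dot_lmul_matrix[of v "replace_row k r" z]
    by (simp add: replace_row_vector inner_commute algebra_simps inner_axis)
  then show ?thesis using vector_eq_ldot by blast
qed

text \<open>With \<open>p = R v\<close>, where \<open>R\<close> has determinant \<open>w $ k\<close> and \<open>k\<close>th row \<open>w\<close>,
  we have \<open>R (I + v w\<^sup>T) = (I + p e\<^sub>k\<^sup>T) R\<close>.\<close>

lemma det_add_outer: "det (mat 1 + outer v w) = 1 + w \<bullet> v"
proof (cases "w = 0")
  case True
  then have "outer v w = 0" by (simp add: outer_def vec_eq_iff)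
  with True show ?thesis by simp
next
  case False
  then obtain k where k: "w $ k \<noteq> 0" by (auto simp: vec_eq_iff)
  let ?R = "replace_row k w" and ?e = "axis k 1 :: real^'a"
  let ?S = "transpose (replace_row k (?e + ?R *v v))"
  have "(?R ** (mat 1 + outer v w)) *v z = (?S ** ?R) *v z" for z
    by (simp del: transpose_matrix_vector add: matrix_vector_mul_assoc[symmetric]
        replace_row_vector transpose_replace_row_vector outer_vector algebra_simps
        inner_axis inner_axis')
  then have "?R ** (mat 1 + outer v w) = ?S ** ?R"
    by (simp add: matrix_eq)
  then have "det ?R * det (mat 1 + outer v w) = det ?S * det ?R"
    by (metis det_mul)
  with k show ?thesis
    by (simp add: det_replace_row replace_row_vector)
qed

text \<open>Symmetric elimination as a congruence: with R = \<open>replace_row k r\<close>, A = R^T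
  A' R and det R = \<open>sqrt (A $ k $ k)\<close>. Subtracting \<open>outer r r\<close> clears row
  and column \<open>k\<close>; the unit put back on the diagonal keeps the dimension.\<close>

lemma pos_def_schur:
  fixes A :: "real^'n^'n" and k :: 'n
  assumes "pos_def A"
  defines "r \<equiv> inverse (sqrt (A $ k $ k)) *\<^sub>R A $ k"
  defines "A' \<equiv> A - outer r r + outer (axis k 1) (axis k 1)"
  shows "pos_def A'" "det A = A $ k $ k * det A'"
proof -
  let ?s = "sqrt (A $ k $ k)" and ?e = "axis k 1 :: real^'n"
  let ?R = "replace_row k r"
  have s: "0 < ?s" "?s * ?s = A $ k $ k" using pos_def_diag[OF assms(1), of k] by auto
  have rk: "r $ k = ?s" using s by (simp add: r_def field_simps)
  have Ae: "A *v ?e = ?s *\<^sub>R r"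
    using s pos_def_entry_sym[OF assms(1)]
    by (simp add: matrix_vector_mul_component vec_eq_iff r_def inner_axis)
  have eA: "(A *v w) $ k = ?s * (r \<bullet> w)" for w
    using pos_def_sym[OF assms(1), of ?e w] by (simp add: Ae inner_axis' inner_commute)
  have form: "(?R *v v) \<bullet> (A' *v (?R *v w)) = v \<bullet> (A *v w)" for v w
    by (simp add: A'_def replace_row_vector outer_vector Ae eA rk algebra_simps inner_axis
        inner_axis' inner_commute)
  have A: "A = transpose ?R ** A' ** ?R"
  proof -
    have "v \<bullet> (A *v w) = v \<bullet> ((transpose ?R ** A' ** ?R) *v w)" for v w
      using form[of v w] dot_lmul_matrix[of "A' *v (?R *v w)" ?R v]
      by (simp add: matrix_vector_mul_assoc[symmetric] inner_commute)
    then show ?thesis by (metis matrix_eq vector_eq_ldot)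
  qed
  have "det A = det (transpose ?R ** A' ** ?R)" using A by simp
  then show "det A = A $ k $ k * det A'"
    using s(2) by (simp add: det_mul det_replace_row rk)
  have "invertible ?R"
    using s by (simp add: invertible_det_nz det_replace_row rk)
  then obtain Q where Q: "?R ** Q = mat 1" by (auto simp: invertible_def)
  have RQ: "?R *v (Q *v v) = v" for v using Q by (simp add: matrix_vector_mul_assoc)
  show "pos_def A'"
  proof (rule pos_defI)
    fix v w
    show "v \<bullet> (A' *v w) = w \<bullet> (A' *v v)"
      using form[of "Q *v v" "Q *v w"] form[of "Q *v w" "Q *v v"] 
        pos_def_sym[OF assms(1), of "Q *v v" "Q *v w"] by (simp add: RQ)
    assume "v \<noteq> 0"
    then have "Q *v v \<noteq> 0" using RQ[of v] by force
    from pos_def_pos[OF assms(1) this] form[of "Q *v v" "Q *v v"] show "0 < v \<bullet> (A' *v v)"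
      by (simp add: RQ)
  qed
qed

text \<open>Elimination of the index \<open>k\<close> by \<open>pos_def_schur\<close> drives the induction on the set of
  rows that differ from the identity.\<close>

lemma hadamard_on:
  fixes A :: "real^'n^'n"
  assumes "finite S" "pos_def A" "\<And>i j. i \<notin> S \<Longrightarrow> A $ i $ j = mat 1 $ i $ j"
  shows "0 < det A \<and> det A \<le> (\<Prod>i\<in>S. A $ i $ i)"
  using assms
proof (induction S arbitrary: A rule: finite_induct)
  case empty
  then have "A = mat 1" by (simp add: vec_eq_iff)
  then show ?case by simp
next
  case (insert k S)
  let ?a = "A $ k $ k"
  define r where "r = inverse (sqrt ?a) *\<^sub>R A $ k"
  define A' where "A' = A - outer r r + outer (axis k 1) (axis k 1)"
  have a: "0 < ?a" using insert.prems by (intro pos_def_diag)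
  note schur = pos_def_schur[OF insert.prems(1), of k, folded r_def, folded A'_def]
  have A'_entry: "A' $ i $ j = A $ i $ j - A $ k $ i * A $ k $ j / ?a
      + (if i = k \<and> j = k then 1 else 0)" for i j
    using a by (auto simp: A'_def r_def outer_def axis_def field_simps)
  have "A' $ i $ j = mat 1 $ i $ j" if "i \<notin> S" for i j
  proof (cases "i = k")
    case True
    with a show ?thesis by (auto simp: A'_entry mat_def)
  next
    case False
    with that have *: "A $ i $ l = mat 1 $ i $ l" for l by (intro insert.prems) auto
    \<comment> \<open>By symmetry entry \<open>i\<close> of the pivot row vanishes, so the other
      identity rows survive the elimination.\<close>
    from this[of k] have "A $ k $ i = 0"
      using False pos_def_entry_sym[OF insert.prems(1), of k i] by (simp add: mat_def)
    with * False show ?thesis by (simp add: A'_entry)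
  qed
  from insert.IH[OF schur(1) this]
  have IH: "0 < det A'" "det A' \<le> (\<Prod>i\<in>S. A' $ i $ i)" by auto
  \<comment> \<open>Elimination subtracts a square over the pivot, so diagonal entries indexed by
    \<open>S\<close> can only decrease.\<close>
  have "(\<Prod>i\<in>S. A' $ i $ i) \<le> (\<Prod>i\<in>S. A $ i $ i)"
  proof (rule prod_mono)
    fix i assume "i \<in> S"
    then have "A' $ i $ i \<le> A $ i $ i"
      using insert.hyps a by (auto simp: A'_entry)
    with pos_def_diag[OF schur(1), of i] show "0 \<le> A' $ i $ i \<and> A' $ i $ i \<le> A $ i $ i" by simp
  qed
  with IH a show ?case
    using insert.hyps by (simp add: schur(2))
qed

lemma pos_def_det_pos: "pos_def A \<Longrightarrow> 0 < det A"
  using hadamard_on[of UNIV A] by simp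

lemma hadamard: "pos_def A \<Longrightarrow> det A \<le> (\<Prod>i\<in>UNIV. A $ i $ i)"
  using hadamard_on[of UNIV A] by simp

text \<open>Hadamard's inequality leaves only diagonal entries, where 1 + a \<le> exp a.\<close>

lemma ln_det_mat_1_add_le:
  assumes "pos_def A" shows "ln (det (mat 1 + A)) \<le> trace A"
proof -
  have "det (mat 1 + A) \<le> (\<Prod>i\<in>UNIV. (mat 1 + A) $ i $ i)"
    by (intro hadamard pos_def_add pos_def_mat_1 assms)
  also have "\<dots> \<le> (\<Prod>i\<in>UNIV. exp (A $ i $ i))"
    using less_imp_le[OF pos_def_diag[OF assms]]
    by (intro prod_mono) (simp add: mat_def add_nonneg_nonneg)
  also have "\<dots> = exp (trace A)"
    by (simp add: exp_sum trace_def)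
  finally have "ln (det (mat 1 + A)) \<le> ln (exp (trace A))"
    using pos_def_det_pos[OF pos_def_add[OF pos_def_mat_1 assms]] by (subst ln_le_cancel_iff) auto
  then show ?thesis by simp
qed

lemma det_scaleR: "det (k *\<^sub>R A) = k ^ CARD('n) * det (A :: real^'n^'n)"
proof -
  have "k *\<^sub>R A = matrix ((*\<^sub>R) k) ** A"
    by (simp add: matrix_eq matrix_vector_mul_assoc[symmetric] matrix_works
        scaleR_matrix_vector_assoc)
  then show ?thesis by (simp add: det_mul)
qed

section \<open>Bounds on trace, quadratic form and leverage\<close>

lemma trace_le_quadratic_form:
  fixes A :: "real^'n^'n"
  assumes "\<And>v. v \<bullet> (A *v v) \<le> B * (v \<bullet> v)"
  shows "trace A \<le> real CARD('n) * B"
proof -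
  have "A $ i $ i \<le> B" for i
    using assms[of "axis i 1"]
    by (simp add: inner_axis_axis matrix_vector_mul_component inner_axis inner_axis')
  then show ?thesis
    unfolding trace_def using sum_bounded_above[of UNIV "\<lambda>i. A $ i $ i" B] by simp
qed

lemma quadratic_form_add_outer_le:
  assumes "\<And>v. v \<bullet> (A *v v) \<le> B * (v \<bullet> v)" and "(norm x)\<^sup>2 \<le> R"
  shows "v \<bullet> ((A + outer x x) *v v) \<le> (B + R) * (v \<bullet> v)"
proof -
  have "(x \<bullet> v)\<^sup>2 \<le> (x \<bullet> x) * (v \<bullet> v)" by (rule Cauchy_Schwarz_ineq)
  also have "\<dots> \<le> R * (v \<bullet> v)"
    using assms(2) by (intro mult_right_mono) (simp_all add: power2_norm_eq_inner)
  finally show ?thesis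
    using assms(1)[of v]
    by (simp add: algebra_simps outer_vector inner_commute power2_eq_square)
qed

text \<open>With D = M + x x^T and p = D^-1 x one has M = D (I - p x^T), so det M / det D = 1 - x
  \<bullet> p; then ln z \<le> z - 1 applies.\<close>

lemma leverage_le_ln_det:
  assumes "pos_def M"
  shows "x \<bullet> (matrix_inv (M + outer x x) *v x) \<le> ln (det (M + outer x x)) - ln (det M)"
proof -
  let ?D = "M + outer x x"
  define p where "p = matrix_inv ?D *v x"
  have D: "pos_def ?D" by (rule pos_def_add_outer[OF assms])
  have "M *v p + (x \<bullet> p) *\<^sub>R x = x"
    using pos_def_inv_vector(1)[OF D, of x]
    by (simp add: p_def[symmetric] matrix_vector_mult_add_rdistrib outer_vector)
  then have Mp: "M *v p = x - (x \<bullet> p) *\<^sub>R x" by (simp add: eq_diff_eq)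
  have "M *v v = (?D ** (mat 1 + outer (- p) x)) *v v" for v
    by (simp add: matrix_vector_mul_assoc[symmetric] outer_vector algebra_simps Mp)
  then have "M = ?D ** (mat 1 + outer (- p) x)" by (simp add: matrix_eq)
  then have det: "det M = det ?D * (1 - x \<bullet> p)"
    by (metis det_mul det_add_outer inner_minus_right add_uminus_conv_diff)
  have pos: "0 < det M" "0 < det ?D" by (simp_all add: pos_def_det_pos assms D)
  with det have "0 < 1 - x \<bullet> p" by (simp add: zero_less_mult_iff)
  with pos have "ln (det M) = ln (det ?D) + ln (1 - x \<bullet> p)" by (simp add: det ln_mult)
  with ln_le_minus_one[OF \<open>0 < 1 - x \<bullet> p\<close>] show ?thesis by (simp add: p_def)
qed

subsection \<open>A single LASER round\<close>

context
  fixes D :: "real^'n^'n" and c :: real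
  assumes D: "pos_def D" and c: "0 < c"
begin

text \<open>\<open>diffuse\<close> is the form that remains when w \<bullet> D w + c |u - w|^2 is
  minimised over w, and \<open>shrink\<close> maps u to the minimising w.\<close>

abbreviation (input) "shrink \<equiv> matrix_inv (mat 1 + inverse c *\<^sub>R D)"
abbreviation (input) "diffuse \<equiv> matrix_inv (matrix_inv D + inverse c *\<^sub>R mat 1)"

lemma pos_def_shift: "pos_def (mat 1 + inverse c *\<^sub>R D)"
  using D c by (intro pos_def_add pos_def_mat_1 pos_def_scaleR) auto

lemma pos_def_shrink: "pos_def shrink"
  by (rule pos_def_matrix_inv[OF pos_def_shift])

lemma pos_def_diffuse: "pos_def diffuse"
  using D c by (intro pos_def_matrix_inv pos_def_add pos_def_scaleR pos_def_mat_1) auto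

text \<open>With K = \<open>shrink\<close>, this lemma, \<open>shrink_mult\<close> and
  \<open>diffuse_eq\<close> write D K, K D and \<open>diffuse\<close> all as c (I - K), which
  removes such products from later calculations.\<close>

lemma mult_shrink: "D *v (shrink *v v) = c *\<^sub>R (v - shrink *v v)"
proof -
  have "shrink *v v + inverse c *\<^sub>R (D *v (shrink *v v)) = v"
    using pos_def_inv_vector(1)[OF pos_def_shift, of v]
    by (simp add: matrix_vector_mult_add_rdistrib scaleR_matrix_vector_assoc)
  then have "c *\<^sub>R (v - shrink *v v) = c *\<^sub>R (inverse c *\<^sub>R (D *v (shrink *v v)))"
    by (metis add_diff_cancel_left')
  with c show ?thesis by simp
qed

lemma shrink_mult: "shrink *v (D *v v) = c *\<^sub>R (v - shrink *v v)"
proof -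
  have "shrink *v v + inverse c *\<^sub>R (shrink *v (D *v v)) = v"
    using pos_def_inv_vector(2)[OF pos_def_shift, of v]
    by (simp add: matrix_vector_mult_add_rdistrib scaleR_matrix_vector_assoc[symmetric]
        matrix_vector_right_distrib matrix_vector_mult_scaleR)
  then have "c *\<^sub>R (v - shrink *v v) = c *\<^sub>R (inverse c *\<^sub>R (shrink *v (D *v v)))"
    by (metis add_diff_cancel_left')
  with c show ?thesis by simp
qed

text \<open>The candidate \<open>?z\<close> equals D K v, hence D^-1 \<open>?z\<close> = K v, and
  adding c^-1 \<open>?z\<close> = v - K v gives back v.\<close>

lemma diffuse_eq: "diffuse *v v = c *\<^sub>R (v - shrink *v v)"
proof -
  let ?P = "matrix_inv D + inverse c *\<^sub>R mat 1"
  let ?z = "c *\<^sub>R (v - shrink *v v)"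
  have P: "pos_def ?P"
    using D c by (intro pos_def_matrix_inv pos_def_add pos_def_scaleR pos_def_mat_1) auto
  have "matrix_inv D *v ?z = shrink *v v"
    using pos_def_inv_vector(2)[OF D, of "shrink *v v"] by (simp add: mult_shrink)
  then have "?P *v ?z = v"
    using c by (simp add: matrix_vector_mult_add_rdistrib scaleR_matrix_vector_assoc[symmetric])
  with pos_def_inv_vector(2)[OF P, of ?z] show ?thesis by simp
qed

lemma det_eq_det_diffuse_mult: "det D = det diffuse * det (mat 1 + inverse c *\<^sub>R D)"
proof -
  have "(diffuse ** (mat 1 + inverse c *\<^sub>R D)) *v v = D *v v" for v
    using c unfolding matrix_vector_mul_assoc[symmetric] diffuse_eq pos_def_inv_vector[OF pos_def_shift]
    by (simp add: matrix_vector_mult_add_rdistrib scaleR_matrix_vector_assoc[symmetric])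
  then show ?thesis by (metis matrix_eq det_mul)
qed

lemma leverage_le:
  "x \<bullet> (matrix_inv (diffuse + outer x x) *v x)
    \<le> ln (det (diffuse + outer x x)) - ln (det D) + inverse c * trace D"
proof -
  have "0 < det diffuse" "0 < det (mat 1 + inverse c *\<^sub>R D)"
    by (simp_all add: pos_def_det_pos pos_def_diffuse pos_def_shift)
  then have "ln (det D) = ln (det diffuse) + ln (det (mat 1 + inverse c *\<^sub>R D))"
    by (simp add: det_eq_det_diffuse_mult ln_mult)
  moreover have "ln (det (mat 1 + inverse c *\<^sub>R D)) \<le> trace (inverse c *\<^sub>R D)"
    using D c by (intro ln_det_mat_1_add_le pos_def_scaleR) auto
  moreover have "trace (inverse c *\<^sub>R D) = inverse c * trace D"
    by (simp add: trace_def sum_distrib_left)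
  ultimately show ?thesis
    using leverage_le_ln_det[OF pos_def_diffuse, of x] by simp
qed

text \<open>The left-hand side is the minimum of the right-hand side over \<open>w\<close>, attained at
  \<open>w = shrink (c\<^sup>-\<^sup>1 e + u)\<close>.\<close>

lemma partial_minimum_le:
  "u \<bullet> (diffuse *v u) - 2 * (u \<bullet> (shrink *v e)) - inverse c * (e \<bullet> (shrink *v e))
    \<le> w \<bullet> (D *v w) - 2 * (w \<bullet> e) + c * (norm (u - w))\<^sup>2"
proof -
  \<comment> \<open>\<open>q\<close> collects the terms linear in \<open>w\<close>, and (D + c I) k
    = c q; the square completed below is that of \<open>w - k\<close>.\<close>
  define q where "q = inverse c *\<^sub>R e + u"
  define k where "k = shrink *v q"
  have Dk: "D *v k = c *\<^sub>R (q - k)" unfolding k_def by (rule mult_shrink)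
  let ?z = "w - k"
  have "0 \<le> ?z \<bullet> (D *v ?z) + c * (?z \<bullet> ?z)"
    using pos_def_nonneg[OF D, of ?z] c by simp
  also have "\<dots> = w \<bullet> (D *v w) - 2 * c * (w \<bullet> q) + c * (w \<bullet> w) + c * (q \<bullet> k)"
  proof -
    have "k \<bullet> (D *v w) = c * (w \<bullet> q) - c * (w \<bullet> k)"
      using pos_def_sym[OF D, of w k] by (simp add: Dk inner_diff_right right_diff_distrib)
    then show ?thesis
      by (simp add: matrix_vector_mult_diff_distrib Dk inner_diff_left inner_diff_right
          algebra_simps inner_commute)
  qed
  also have "c * (q \<bullet> k)
      = inverse c * (e \<bullet> (shrink *v e)) + 2 * (u \<bullet> (shrink *v e)) + c * (u \<bullet> (shrink *v u))"
    using c pos_def_sym[OF pos_def_shrink, of e u]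
    by (simp add: q_def k_def matrix_vector_right_distrib matrix_vector_mult_scaleR inner_add_left
        inner_add_right field_simps)
  also have "2 * c * (w \<bullet> q) = 2 * (w \<bullet> e) + 2 * c * (w \<bullet> u)"
    using c by (simp add: q_def inner_add_right distrib_left)
  finally show ?thesis
    by (simp add: diffuse_eq power2_norm_eq_inner inner_diff_left inner_diff_right
        right_diff_distrib distrib_left inner_commute)
qed

text \<open>The partial minimum with \<open>e = 0\<close> is tested at w = k u, where k = c / (c +
  B) minimises B k^2 + c (1 - k)^2.\<close>

lemma quadratic_form_diffuse_le:
  assumes "\<And>v. v \<bullet> (D *v v) \<le> B * (v \<bullet> v)" "0 \<le> B"
  shows "u \<bullet> (diffuse *v u) \<le> c * B / (c + B) * (u \<bullet> u)"
proof -
  define k where "k = c / (c + B)"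
  have k: "1 - k = B / (c + B)" using c assms(2) by (simp add: k_def field_simps)
  have "u \<bullet> (diffuse *v u) \<le> (k *\<^sub>R u) \<bullet> (D *v (k *\<^sub>R u)) + c * (norm (u - k *\<^sub>R u))\<^sup>2"
    using partial_minimum_le[of u 0 "k *\<^sub>R u"] by simp
  also have "\<dots> \<le> B * ((k *\<^sub>R u) \<bullet> (k *\<^sub>R u)) + c * (norm ((1 - k) *\<^sub>R u))\<^sup>2"
    using assms(1)[of "k *\<^sub>R u"] by (simp add: scaleR_diff_left)
  also have "\<dots> = (B * k\<^sup>2 + c * (1 - k)\<^sup>2) * (u \<bullet> u)"
    by (simp add: power_mult_distrib power2_norm_eq_inner distrib_right)
      (simp add: power2_eq_square)
  also have "B * k\<^sup>2 + c * (1 - k)\<^sup>2 = c * B / (c + B)"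
  proof -
    have "B * k\<^sup>2 + c * (1 - k)\<^sup>2 = (c * B * (c + B)) / (c + B)\<^sup>2"
      unfolding k by (simp add: k_def power_divide add_divide_distrib[symmetric])
        (simp add: power2_eq_square algebra_simps)
    then show ?thesis using c assms(2) by (simp add: power2_eq_square)
  qed
  finally show ?thesis .
qed

text \<open>The prediction is x \<bullet> q. After expansion the terms in y cancel and the claim
  becomes (x \<bullet> q)^2 \<le> g \<bullet> p - g \<bullet> q, which compares the inverses of
  \<open>diffuse\<close> and \<open>D'\<close> at g.\<close>

lemma round_loss_le:
  fixes x e :: "real^'n" and y :: real
  defines "D' \<equiv> diffuse + outer x x" and "e' \<equiv> shrink *v e + y *\<^sub>R x"
  shows "(y - x \<bullet> (matrix_inv D' *v (shrink *v e)))\<^sup>2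
    \<le> (y\<^sup>2 - inverse c * (e \<bullet> (shrink *v e)) - e' \<bullet> (matrix_inv D' *v e'))
      + e \<bullet> (matrix_inv D *v e) + y\<^sup>2 * (x \<bullet> (matrix_inv D' *v x))"
proof -
  have D': "pos_def D'" unfolding D'_def by (rule pos_def_add_outer[OF pos_def_diffuse])
  define g where "g = shrink *v e"
  define p where "p = matrix_inv D *v e"
  define q where "q = matrix_inv D' *v g"
  have Dp: "D *v p = e" by (simp add: p_def pos_def_inv_vector[OF D])
  have Mp: "diffuse *v p = g" using shrink_mult[of p] by (simp only: diffuse_eq Dp g_def)
  have "(diffuse + outer x x) *v q = g"
    using pos_def_inv_vector(1)[OF D', of g] unfolding q_def D'_def .
  then have gq: "g = diffuse *v q + (x \<bullet> q) *\<^sub>R x"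
    by (simp add: matrix_vector_mult_add_rdistrib outer_vector)
  \<comment> \<open>Since \<open>diffuse\<close> maps p to g, the right-hand side is the inverse
    form of \<open>diffuse\<close> at g.\<close>
  have gp: "e \<bullet> p - inverse c * (e \<bullet> g) = g \<bullet> p"
  proof -
    have "e \<bullet> g = c * (p \<bullet> e - p \<bullet> g)"
      using pos_def_sym[OF D, of p g] mult_shrink[of e]
      by (simp add: g_def[symmetric] Dp inner_commute inner_diff_right)
    with c show ?thesis by (simp add: inner_commute field_simps)
  qed
  have "(x \<bullet> q)\<^sup>2 \<le> g \<bullet> p - g \<bullet> q"
  proof -
    let ?h = "p - q"
    \<comment> \<open>Nonnegativity of \<open>diffuse\<close> at \<open>?h\<close> is exactly the
      missing inequality, once g \<bullet> \<open>?h\<close> is split by \<open>gq\<close>.\<close>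
    have Mh: "diffuse *v ?h = (x \<bullet> q) *\<^sub>R x"
      unfolding matrix_vector_mult_diff_distrib Mp using gq by (metis add_diff_cancel_left')
    have "0 \<le> (x \<bullet> q) * (x \<bullet> ?h)"
      using pos_def_nonneg[OF pos_def_diffuse, of ?h] by (simp add: Mh inner_commute)
    also have "\<dots> = g \<bullet> ?h - (x \<bullet> q)\<^sup>2"
    proof -
      have "g \<bullet> ?h = ?h \<bullet> (diffuse *v q) + (x \<bullet> q) * (x \<bullet> ?h)"
        by (subst inner_commute, subst gq)
          (simp only: inner_add_right inner_scaleR_right inner_commute[of x ?h])
      also have "?h \<bullet> (diffuse *v q) = (x \<bullet> q)\<^sup>2"
        using pos_def_sym[OF pos_def_diffuse, of ?h q]
        by (simp add: Mh inner_commute power2_eq_square)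
      finally show ?thesis by simp
    qed
    finally show ?thesis by (simp add: inner_diff_right)
  qed
  moreover have "e' \<bullet> (matrix_inv D' *v e')
      = g \<bullet> q + 2 * y * (x \<bullet> q) + y\<^sup>2 * (x \<bullet> (matrix_inv D' *v x))"
    using pos_def_sym[OF pos_def_matrix_inv[OF D'], of g x]
    by (simp add: e'_def g_def[symmetric] q_def matrix_vector_right_distrib
        matrix_vector_mult_scaleR inner_add_left inner_add_right power2_eq_square distrib_left)
  ultimately show ?thesis
    using gp by (simp add: g_def[symmetric] q_def[symmetric] p_def[symmetric] power2_eq_square
        algebra_simps)
qed

end

subsection \<open>Real inequalities for the tuning\<close>

text \<open>Clearing denominators leaves B^2 - S B - S c \<ge> 0, and the hypothesis places B above
  the larger root.\<close>

lemma eigenvalue_bound_invariant: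
  fixes c S :: real
  assumes "0 < c" "0 \<le> S" "(3 * S + sqrt (S\<^sup>2 + 4 * S * c)) / 2 \<le> B"
  shows "c * B / (c + B) + S \<le> B"
proof -
  define r where "r = sqrt (S\<^sup>2 + 4 * S * c)"
  have r: "0 \<le> r" "r\<^sup>2 = S\<^sup>2 + 4 * S * c" "3 * S + r \<le> 2 * B"
    using assms by (auto simp: r_def)
  have B: "0 \<le> B" using assms(2) r(1,3) by linarith
  have "r \<le> 2 * B - S" using assms(2) r(1,3) by linarith
  then have "r\<^sup>2 \<le> (2 * B - S)\<^sup>2" using r(1) by (rule power_mono)
  then have "S * (c + B) \<le> B * B"
    unfolding r(2) by (simp add: power2_eq_square algebra_simps)
  with assms(1) B show ?thesis by (simp add: field_simps)
qed

text \<open>The right-hand side squares to 8 X^2 c. The first entry of the lower bound on c controls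
  3 X^2 and the root, the second controls b + X^2.\<close>

lemma eigenvalue_bound_le_sqrt:
  fixes b c X :: real
  assumes "0 < X" "0 < b" "max (9 / 8 * X\<^sup>2) ((b + X\<^sup>2)\<^sup>2 / (8 * X\<^sup>2)) \<le> c"
  shows "max ((3 * X\<^sup>2 + sqrt (X ^ 4 + 4 * X\<^sup>2 * c)) / 2) (b + X\<^sup>2) \<le> 2 * sqrt 2 * X * sqrt c"
proof -
  have c: "9 * X\<^sup>2 \<le> 8 * c" "(b + X\<^sup>2)\<^sup>2 \<le> 8 * X\<^sup>2 * c" "0 \<le> c"
    using assms by (auto simp: field_simps intro: order_trans[of 0 "9 / 8 * X\<^sup>2"])
  let ?R = "2 * sqrt 2 * X * sqrt c"
  have R: "0 \<le> ?R" "?R\<^sup>2 = 8 * X\<^sup>2 * c"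
    using assms(1) c by (simp_all add: power_mult_distrib)
  have X4: "9 * X ^ 4 \<le> 8 * X\<^sup>2 * c"
    using mult_left_mono[OF c(1), of "X\<^sup>2"] by (simp add: power4_eq_xxxx power2_eq_square algebra_simps)
  have "3 * X\<^sup>2 \<le> ?R"
  proof (rule power2_le_imp_le)
    show "(3 * X\<^sup>2)\<^sup>2 \<le> ?R\<^sup>2" unfolding R(2) using X4 by (simp add: power_mult_distrib)
  qed (fact R)
  moreover have "sqrt (X ^ 4 + 4 * X\<^sup>2 * c) \<le> ?R"
  proof (rule real_le_lsqrt)
    have "0 \<le> X\<^sup>2 * c" using c by simp
    with X4 show "X ^ 4 + 4 * X\<^sup>2 * c \<le> ?R\<^sup>2" unfolding R(2) by linarith
  qed (fact R)
  moreover have "b + X\<^sup>2 \<le> ?R"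
  proof (rule power2_le_imp_le)
    show "(b + X\<^sup>2)\<^sup>2 \<le> ?R\<^sup>2" unfolding R(2) by (fact c)
  qed (fact R)
  ultimately show ?thesis by simp
qed

text \<open>This c minimises the left-hand side. With c = q^2 and A \<tau> = V q^3 the second
  summand is twice the first, hence the factor 3. The bound on V is \<mu> \<le> c rewritten.\<close>

lemma powr_two_thirds_tuning:
  fixes A V \<tau> c \<mu> :: real
  assumes "0 < A" "0 < V" "0 < \<tau>" and c: "c = (A * \<tau> / V) powr (2 / 3)"
  shows "c * V + 2 * A * \<tau> / sqrt c = 3 * A powr (2 / 3) * \<tau> powr (2 / 3) * V powr (1 / 3)"
    and "0 < \<mu> \<Longrightarrow> V \<le> \<tau> * (A / \<mu> powr (3 / 2)) \<Longrightarrow> \<mu> \<le> c"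
proof -
  define q where "q = (A * \<tau> / V) powr (1 / 3)"
  have pos: "0 < A * \<tau> / V" using assms by simp
  then have q: "0 < q" using assms(1-3) by (simp add: q_def)
  have c_q: "c = q\<^sup>2" using pos by (simp only: c q_def powr_power) simp
  have "q ^ 3 = (A * \<tau> / V) powr 1" 
    using assms(1-3) by (subst q_def, subst powr_power) simp_all
  then have "q ^ 3 = A * \<tau> / V" by (simp only: powr_one[OF less_imp_le[OF pos]])
  then have "2 * A * \<tau> = 2 * V * q ^ 3" using assms(2) by simp
  moreover have "sqrt c = q" using q by (simp add: c_q)
  ultimately have "2 * A * \<tau> / sqrt c = 2 * c * V"
    using q by (simp only: c_q) (simp add: power3_eq_cube power2_eq_square)
  moreover have "c * V = A powr (2 / 3) * \<tau> powr (2 / 3) * V powr (1 / 3)"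
  proof -
    have "V / V powr (2 / 3) = V powr (1 / 3)"
      using assms(2) powr_diff[of V 1 "2 / 3"] by simp
    moreover have "c * V = A powr (2 / 3) * \<tau> powr (2 / 3) * (V / V powr (2 / 3))"
      using assms(1-3) by (simp add: c powr_divide powr_mult)
    ultimately show ?thesis by simp
  qed
  ultimately show "c * V + 2 * A * \<tau> / sqrt c
      = 3 * A powr (2 / 3) * \<tau> powr (2 / 3) * V powr (1 / 3)" by simp
  assume \<mu>: "0 < \<mu>" "V \<le> \<tau> * (A / \<mu> powr (3 / 2))"
  then have "\<mu> powr (3 / 2) \<le> A * \<tau> / V"
    using assms(1-3) by (simp add: field_simps)
  then have "(\<mu> powr (3 / 2)) powr (2 / 3) \<le> c"
    unfolding c by (intro powr_mono2) auto
  with \<mu> show "\<mu> \<le> c" by (simp add: powr_powr)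
qed

subsection \<open>Regret of LASER\<close>

lemma pos_def_laser_D:
  assumes "0 < b" "b < c"
  shows "pos_def (laser_D b c x t)"
proof (induction t)
  case 0
  with assms show ?case by (auto intro!: pos_def_scaleR pos_def_mat_1)
next
  case (Suc t)
  with assms show ?case by (auto intro!: pos_def_add_outer pos_def_diffuse)
qed

text \<open>The initial scale a = bc/(c-b) solves 1/a + 1/c = 1/b, so one drift step turns it into
  the regulariser b.\<close>

lemma laser_D_1_shift_le:
  assumes "0 < b" "b < c"
  shows "u \<bullet> (matrix_inv (matrix_inv (laser_D b c x 0) + inverse c *\<^sub>R mat 1) *v u)
    \<le> b * (u \<bullet> u)"
proof -
  let ?a = "b * c / (c - b)"
  have "c + ?a = c * c / (c - b)" "0 \<le> ?a" using assms by (simp_all add: field_simps)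
  then have "c * ?a / (c + ?a) = b" using assms by simp
  moreover have "v \<bullet> (laser_D b c x 0 *v v) \<le> ?a * (v \<bullet> v)" for v
    by (simp add: scaleR_matrix_vector_assoc[symmetric])
  ultimately show ?thesis
    using quadratic_form_diffuse_le[OF pos_def_laser_D[OF assms], of c x 0 ?a u] assms \<open>0 \<le> ?a\<close>
    by simp
qed

text \<open>The induction starts at round 1 because \<open>laser_D b c x 0\<close> may exceed B;
  this is why its trace appears separately in the regret bound.\<close>

lemma laser_D_quadratic_form_le:
  assumes "0 < b" "b < c"
    and x: "\<And>t. 1 \<le> t \<Longrightarrow> t \<le> T \<Longrightarrow> (norm (x t))\<^sup>2 \<le> S"
    and B: "(3 * S + sqrt (S\<^sup>2 + 4 * S * c)) / 2 \<le> B" "b + S \<le> B"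
    and "1 \<le> t" "t \<le> T"
  shows "v \<bullet> (laser_D b c x t *v v) \<le> B * (v \<bullet> v)"
  using \<open>1 \<le> t\<close> \<open>t \<le> T\<close>
proof (induction t arbitrary: v rule: dec_induct)
  case base
  have "v \<bullet> (laser_D b c x 1 *v v) \<le> (b + S) * (v \<bullet> v)"
    using quadratic_form_add_outer_le[OF laser_D_1_shift_le[OF assms(1,2)] x[of 1]] base by simp
  also have "\<dots> \<le> B * (v \<bullet> v)" using B(2) by (intro mult_right_mono) auto
  finally show ?case .
next
  case (step t)
  have S: "0 \<le> S" using x[of 1] step by (intro order_trans[OF zero_le_power2]) auto
  then have "0 \<le> B" using B(2) assms(1) by linarith
  then have "v \<bullet> (laser_D b c x (Suc t) *v v) \<le> (c * B / (c + B) + S) * (v \<bullet> v)"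
    using step assms(1,2) x[of "Suc t"]
    by (auto intro!: quadratic_form_add_outer_le quadratic_form_diffuse_le pos_def_laser_D)
  also have "\<dots> \<le> B * (v \<bullet> v)"
    using assms(1,2) S B(1) by (intro mult_right_mono eigenvalue_bound_invariant) auto
  finally show ?case .
qed

text \<open>The constant term \<open>f\<^sub>t\<close> of the minimised quadratic.\<close>

definition laser_const ::
  "real \<Rightarrow> real \<Rightarrow> (nat \<Rightarrow> real^'n) \<Rightarrow> (nat \<Rightarrow> real) \<Rightarrow> nat \<Rightarrow> real" where
  "laser_const b c x y T = (\<Sum>t<T. (y (Suc t))\<^sup>2 - inverse c *
     (laser_e b c x y t \<bullet>
       (matrix_inv (mat 1 + inverse c *\<^sub>R laser_D b c x t) *v laser_e b c x y t)))"

text \<open>Each partial minimum is bounded by its value at the actual comparator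
  \<open>u t\<close>; round 1 uses up the regulariser.\<close>

lemma laser_min_cost_le_comparator:
  assumes "0 < b" "b < c" "1 \<le> T"
  shows "u T \<bullet> (laser_D b c x T *v u T) - 2 * (u T \<bullet> laser_e b c x y T) + laser_const b c x y T
    \<le> b * (norm (u 1))\<^sup>2 + comparator_loss x y u T + c * total_drift u T"
  using \<open>1 \<le> T\<close>
proof (induction T rule: dec_induct)
  case base
  show ?case
    using laser_D_1_shift_le[OF assms(1,2), of "u 1" x]
    by (simp add: matrix_vector_mult_add_rdistrib outer_vector laser_const_def comparator_loss_def
        total_drift_def inner_add_right power2_norm_eq_inner power2_diff distrib_left
        inner_commute power2_eq_square[of "inner _ _"] del: laser_D.simps(1))
next
  case (step t)
  let ?u = "u (Suc t)" and ?x = "x (Suc t)" and ?y = "y (Suc t)"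
  have drift: "total_drift u (Suc t) = total_drift u t + (norm (?u - u t))\<^sup>2"
    using step.hyps by (simp add: total_drift_def)
  have loss: "comparator_loss x y u (Suc t) = comparator_loss x y u t + (?y - ?u \<bullet> ?x)\<^sup>2"
    by (simp add: comparator_loss_def)
  show ?case
    using partial_minimum_le[OF pos_def_laser_D[OF assms(1,2)], of c ?u x t "laser_e b c x y t" "u t"]
      assms step.IH
    by (simp add: drift loss matrix_vector_mult_add_rdistrib outer_vector laser_const_def
        inner_add_right distrib_left power2_diff inner_commute power2_eq_square[of "inner _ _"])
qed

lemma laser_loss_le_potential:
  assumes "0 < b" "b < c"
  shows "laser_loss b c x y T
    \<le> laser_const b c x y T
      - laser_e b c x y T \<bullet> (matrix_inv (laser_D b c x T) *v laser_e b c x y T)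
      + (\<Sum>t=1..T. (y t)\<^sup>2 * (x t \<bullet> (matrix_inv (laser_D b c x t) *v x t)))"
proof (induction T)
  case 0
  show ?case by (simp add: laser_loss_def laser_const_def)
next
  case (Suc T)
  then show ?case
    using round_loss_le[OF pos_def_laser_D[OF assms], of c "y (Suc T)" "x (Suc T)" x T
        "laser_e b c x y T"] assms
    by (simp add: laser_loss_def laser_const_def laser_pred_def)
qed

text \<open>The traces run one round behind the leverages, so they include round 0.\<close>

lemma sum_leverage_le:
  assumes "0 < b" "b < c"
  shows "(\<Sum>t=1..T. x t \<bullet> (matrix_inv (laser_D b c x t) *v x t))
    \<le> ln (det (laser_D b c x T)) - ln (det (laser_D b c x 0))
      + inverse c * (\<Sum>t<T. trace (laser_D b c x t))"
proof (induction T)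
  case 0
  show ?case by simp
next
  case (Suc T)
  then show ?case
    using leverage_le[OF pos_def_laser_D[OF assms], of c "x (Suc T)" x T] assms
    by (simp add: distrib_left del: laser_D.simps(1))
qed

lemma laser_regret_le:
  fixes x :: "nat \<Rightarrow> real^'n"
  assumes bc: "0 < b" "b < c" and "1 \<le> T"
    and x: "\<And>t. 1 \<le> t \<Longrightarrow> t \<le> T \<Longrightarrow> (norm (x t))\<^sup>2 \<le> S"
    and y: "\<And>t. 1 \<le> t \<Longrightarrow> t \<le> T \<Longrightarrow> \<bar>y t\<bar> \<le> Y"
    and B: "(3 * S + sqrt (S\<^sup>2 + 4 * S * c)) / 2 \<le> B" "b + S \<le> B"
  shows "laser_loss b c x y T
    \<le> b * (norm (u 1))\<^sup>2 + comparator_loss x y u T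
      + Y\<^sup>2 * ln (det ((1 / b) *\<^sub>R laser_D b c x T))
      + inverse c * Y\<^sup>2 * trace (laser_D b c x 0)
      + c * total_drift u T
      + inverse c * Y\<^sup>2 * real T * real CARD('n) * B"
proof -
  let ?D = "laser_D b c x" and ?e = "laser_e b c x y T"
  let ?lev = "\<lambda>t. x t \<bullet> (matrix_inv (?D t) *v x t)"
  note D = pos_def_laser_D[OF bc, of x]
  \<comment> \<open>Completing the square at \<open>u T\<close> bounds the final quadratic below by
    its unconstrained minimum.\<close>
  have "- (?e \<bullet> (matrix_inv (?D T) *v ?e)) \<le> u T \<bullet> (?D T *v u T) - 2 * (u T \<bullet> ?e)"
    using pos_def_nonneg[OF D[of T], of "u T - matrix_inv (?D T) *v ?e"]
      pos_def_sym[OF D[of T], of "matrix_inv (?D T) *v ?e" "u T"]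
    by (simp add: matrix_vector_mult_diff_distrib pos_def_inv_vector[OF D] inner_diff_left
        inner_diff_right inner_commute)
  with laser_min_cost_le_comparator[OF bc \<open>1 \<le> T\<close>, of u x y] laser_loss_le_potential[OF bc, of x y T]
  have loss: "laser_loss b c x y T \<le> b * (norm (u 1))\<^sup>2 + comparator_loss x y u T
      + c * total_drift u T + (\<Sum>t=1..T. (y t)\<^sup>2 * ?lev t)"
    by linarith
  have "(y t)\<^sup>2 * ?lev t \<le> Y\<^sup>2 * ?lev t" if "t \<in> {1..T}" for t
  proof (rule mult_right_mono)
    show "(y t)\<^sup>2 \<le> Y\<^sup>2" using y[of t] that by (simp add: abs_le_square_iff[symmetric])
    show "0 \<le> ?lev t" by (intro pos_def_nonneg pos_def_matrix_inv D)
  qed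
  then have lev: "(\<Sum>t=1..T. (y t)\<^sup>2 * ?lev t) \<le> Y\<^sup>2 * (\<Sum>t=1..T. ?lev t)"
    unfolding sum_distrib_left by (rule sum_mono)
  have "0 \<le> S" using x[of 1] \<open>1 \<le> T\<close> by (intro order_trans[OF zero_le_power2]) auto
  then have B0: "0 \<le> B" using B(2) bc by linarith
  \<comment> \<open>Round 0 is split off, since the bound B holds only from round 1 on.\<close>
  have "(\<Sum>t<T. trace (?D t)) = trace (?D 0) + (\<Sum>t=1..<T. trace (?D t))"
    using \<open>1 \<le> T\<close> by (simp add: lessThan_atLeast0 sum.atLeast_Suc_lessThan del: laser_D.simps(1))
  also have "(\<Sum>t=1..<T. trace (?D t)) \<le> (\<Sum>t=1..<T. real CARD('n) * B)"
    by (intro sum_mono trace_le_quadratic_form laser_D_quadratic_form_le[OF bc x B]) auto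
  also have "\<dots> \<le> real T * (real CARD('n) * B)"
    using B0 by (simp add: mult_right_mono)
  finally have tr: "(\<Sum>t<T. trace (?D t)) \<le> trace (?D 0) + real T * (real CARD('n) * B)"
    by simp
  \<comment> \<open>As bc/(c-b) \<ge> b, replacing det D_0 by the determinant of b I can only
    enlarge the bound.\<close>
  have ln_det: "ln (det (?D T)) - ln (det (?D 0)) \<le> ln (det ((1 / b) *\<^sub>R ?D T))"
  proof -
    have "b \<le> b * c / (c - b)" using bc by (simp add: field_simps)
    then have "b ^ CARD('n) \<le> det (?D 0)"
      using bc by (simp add: det_scaleR power_mono)
    then have "ln (b ^ CARD('n)) \<le> ln (det (?D 0))"
      using bc pos_def_det_pos[OF D[of 0]] by (subst ln_le_cancel_iff) auto
    moreover have "ln (det ((1 / b) *\<^sub>R ?D T)) = ln (det (?D T)) - ln (b ^ CARD('n))"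
      using bc pos_def_det_pos[OF D[of T]]
      by (simp add: det_scaleR power_divide ln_div)
    ultimately show ?thesis by linarith
  qed
  have "(\<Sum>t=1..T. ?lev t) \<le> ln (det ((1 / b) *\<^sub>R ?D T))
      + inverse c * (trace (?D 0) + real T * (real CARD('n) * B))"
  proof -
    have "inverse c * (\<Sum>t<T. trace (?D t))
        \<le> inverse c * (trace (?D 0) + real T * (real CARD('n) * B))"
      using bc by (intro mult_left_mono tr) auto
    with sum_leverage_le[OF bc, of x T] ln_det show ?thesis by linarith
  qed
  then have "Y\<^sup>2 * (\<Sum>t=1..T. ?lev t) \<le> Y\<^sup>2 * (ln (det ((1 / b) *\<^sub>R ?D T))
      + inverse c * (trace (?D 0) + real T * (real CARD('n) * B)))"
    by (rule mult_left_mono) simp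
  with loss lev show ?thesis
    by (simp add: algebra_simps del: laser_D.simps(1))
qed

section \<open>The tuned bound\<close>

lemma tuned_drift_cost_le:
  fixes b c X Y \<tau> d V :: real
  assumes "0 < X" "0 < Y" "0 < \<tau>" "0 < d" "0 < V" "0 < b"
    and \<mu>: "\<mu> = max (9 / 8 * X\<^sup>2) ((b + X\<^sup>2)\<^sup>2 / (8 * X\<^sup>2))"
    and V: "V \<le> \<tau> * (sqrt 2 * Y\<^sup>2 * d * X / \<mu> powr (3 / 2))"
    and c: "c = (sqrt 2 * \<tau> * Y\<^sup>2 * d * X / V) powr (2 / 3)"
  shows "c * V + inverse c * Y\<^sup>2 * \<tau> * d
      * max ((3 * X\<^sup>2 + sqrt (X ^ 4 + 4 * X\<^sup>2 * c)) / 2) (b + X\<^sup>2)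
    \<le> 3 * (sqrt 2 * Y\<^sup>2 * d * X) powr (2 / 3) * \<tau> powr (2 / 3) * V powr (1 / 3)"
proof -
  let ?A = "sqrt 2 * Y\<^sup>2 * d * X"
  have A: "0 < ?A" using assms(1-4) by simp
  have c': "c = (?A * \<tau> / V) powr (2 / 3)" using c by (simp only: mult_ac)
  note tuning = powr_two_thirds_tuning[OF A assms(5,3) c']
  have "0 < 9 / 8 * X\<^sup>2" using assms(1) by simp
  then have \<mu>_pos: "0 < \<mu>" unfolding \<mu> by (rule less_le_trans) (rule max.cobounded1)
  from tuning(2)[OF this V] have c_ge: "\<mu> \<le> c" .
  with \<mu>_pos have c_pos: "0 < c" by simp
  from c_ge have B: "max ((3 * X\<^sup>2 + sqrt (X ^ 4 + 4 * X\<^sup>2 * c)) / 2) (b + X\<^sup>2)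
      \<le> 2 * sqrt 2 * X * sqrt c"
    unfolding \<mu> by (rule eigenvalue_bound_le_sqrt[OF assms(1,6)])
  have "inverse c * Y\<^sup>2 * \<tau> * d * max ((3 * X\<^sup>2 + sqrt (X ^ 4 + 4 * X\<^sup>2 * c)) / 2) (b + X\<^sup>2)
      \<le> inverse c * Y\<^sup>2 * \<tau> * d * (2 * sqrt 2 * X * sqrt c)"
    using c_pos assms(3,4) by (intro mult_left_mono[OF B]) simp
  \<comment> \<open>The factor 2 sqrt 2 X regroups into 2 \<open>?A\<close>, matching the term 2 A
    \<tau> / sqrt c of \<open>powr_two_thirds_tuning\<close>.\<close>
  also have "\<dots> = 2 * ?A * \<tau> * (inverse c * sqrt c)"
    by (simp only: mult_ac)
  also have "inverse c * sqrt c = inverse (sqrt c)"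
    using c_pos by (simp add: field_simps)
  finally show ?thesis
    using tuning(1) by (simp only: divide_inverse)
qed

lemma trace_laser_D_0:
  assumes "0 < c" "\<epsilon> < 1" "b = \<epsilon> * c"
  shows "inverse c * trace (laser_D b c (x :: nat \<Rightarrow> real^'n) 0) = \<epsilon> / (1 - \<epsilon>) * real CARD('n)"
proof -
  have "b * c / (c - b) = c * (\<epsilon> / (1 - \<epsilon>))"
    using assms by (simp add: field_simps)
  then show ?thesis
    using assms(1) by (simp add: trace_def mat_def)
qed

theorem corollary12:
  fixes b c X Y :: real and T :: nat
    and x :: "nat \<Rightarrow> real^'n" and y :: "nat \<Rightarrow> real" and u :: "nat \<Rightarrow> real^'n"
  assumes "0 < b" and "b < c" and "0 < X" and "0 < Y" and "1 \<le> T"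
    and "\<And>t. 1 \<le> t \<Longrightarrow> t \<le> T \<Longrightarrow> (norm (x t))\<^sup>2 \<le> X\<^sup>2"
    and "\<And>t. 1 \<le> t \<Longrightarrow> t \<le> T \<Longrightarrow> \<bar>y t\<bar> \<le> Y"
  shows "laser_loss b c x y T
      \<le> b * (norm (u 1))\<^sup>2 + comparator_loss x y u T
        + Y\<^sup>2 * ln (det ((1 / b) *\<^sub>R laser_D b c x T))
        + inverse c * Y\<^sup>2 * trace (laser_D b c x 0)
        + c * total_drift u T
        + inverse c * Y\<^sup>2 * real T * real CARD('n)
            * max ((3 * X\<^sup>2 + sqrt (X ^ 4 + 4 * X\<^sup>2 * c)) / 2) (b + X\<^sup>2)
    \<and> (\<forall>\<epsilon> \<mu>. 0 < \<epsilon> \<longrightarrow> \<epsilon> < 1 \<longrightarrow> b = \<epsilon> * c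
        \<longrightarrow> \<mu> = max (9 / 8 * X\<^sup>2) ((b + X\<^sup>2)\<^sup>2 / (8 * X\<^sup>2))
        \<longrightarrow> 0 < total_drift u T
        \<longrightarrow> total_drift u T \<le> real T * (sqrt 2 * Y\<^sup>2 * real CARD('n) * X / \<mu> powr (3 / 2))
        \<longrightarrow> c = (sqrt 2 * real T * Y\<^sup>2 * real CARD('n) * X / total_drift u T) powr (2 / 3)
        \<longrightarrow> laser_loss b c x y T
              \<le> b * (norm (u 1))\<^sup>2
                + 3 * (sqrt 2 * Y\<^sup>2 * real CARD('n) * X) powr (2 / 3)
                    * real T powr (2 / 3) * total_drift u T powr (1 / 3)
                + \<epsilon> / (1 - \<epsilon>) * Y\<^sup>2 * real CARD('n)
                + comparator_loss x y u T
                + Y\<^sup>2 * ln (det ((1 / b) *\<^sub>R laser_D b c x T)))"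
proof (intro conjI allI impI, goal_cases)
  case 1
  \<comment> \<open>\<open>laser_regret_le\<close> is applied with S = X^2 and B the maximum; this
    identity matches the two forms of the root.\<close>
  have "(X\<^sup>2)\<^sup>2 = X ^ 4" by simp
  then show ?case
    by (intro laser_regret_le[OF assms(1,2,5-7)]) (simp_all only: max.cobounded1 max.cobounded2)
next
  case tuned: (2 \<epsilon> \<mu>)
  have "0 < c" "0 < real T" using assms(1,2,5) by simp_all
  have "(X\<^sup>2)\<^sup>2 = X ^ 4" by simp
  then have "laser_loss b c x y T
      \<le> b * (norm (u 1))\<^sup>2 + comparator_loss x y u T
        + Y\<^sup>2 * ln (det ((1 / b) *\<^sub>R laser_D b c x T))
        + inverse c * Y\<^sup>2 * trace (laser_D b c x 0)
        + c * total_drift u T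
        + inverse c * Y\<^sup>2 * real T * real CARD('n)
            * max ((3 * X\<^sup>2 + sqrt (X ^ 4 + 4 * X\<^sup>2 * c)) / 2) (b + X\<^sup>2)"
    by (intro laser_regret_le[OF assms(1,2,5-7)]) (simp_all only: max.cobounded1 max.cobounded2)
  moreover have "inverse c * Y\<^sup>2 * trace (laser_D b c x 0) = \<epsilon> / (1 - \<epsilon>) * Y\<^sup>2 * real CARD('n)"
    using trace_laser_D_0[OF \<open>0 < c\<close> tuned(2,3), of x] by (metis mult.assoc mult.commute)
  moreover note tuned_drift_cost_le[OF assms(3,4) \<open>0 < real T\<close> _ tuned(5) assms(1) tuned(4,6,7)]
  ultimately show ?case by simp
qed

end
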